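(* Let $r\geq 2$ be an integer and let $n$ and $j$ be positive integers. Define $$t_{n,j}^{(r)}(q)=q^{r\binom{j+1}{2}}\sum_{k=j}^n(-1)^{n-k}\frac{1-q^{2k+1}}{1-q^{n+k+1}}{2n\brack n-k}{k+j\brack k-j}^r q^{\binom{k}{2}-rjk}.$$ Then $$q^{(r-1)\binom{n}{2}}{2j\brack j}{2n\brack n}^{-1}t_{n,j}^{(r)}(q)\in\mathbb{N}[q],$$ i.e. it is a polynomial in $q$ with nonnegative integer coefficients.
   Context: For an integer $n\ge 0$, $(q)_n=(1-q)(1-q^2)\cdots(1-q^n)$ (with $(q)_0=1$). The $q$-binomial coefficient is ${n\brack k}=\frac{(q)_n}{(q)_k(q)_{n-k}}$ for $0\le k\le n$, and $0$ otherwise. An empty sum (when $j>n$) equals $0$. *)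

theory Defs
  imports "HOL-Computational_Algebra.Computational_Algebra"
begin

text \<open>
  The indeterminate \<open>q\<close> lives in the field of rational functions \<open>\<int>(q)\<close>, realised as the fraction
  field of \<open>\<int>[q]\<close>. The functions below take \<open>q\<close> as an element of an arbitrary field; their quotients
  have the intended meaning whenever \<open>q\<close> is nonzero and not a root of unity, as is the case
  for the indeterminate.
\<close>

definition qvar :: "int poly fract" where
  "qvar = to_fract [:0, 1:]"

definition q_fact :: "'a::field \<Rightarrow> nat \<Rightarrow> 'a" where
  "q_fact q n = (\<Prod>i=1..n. 1 - q ^ i)"

definition q_binomial :: "'a::field \<Rightarrow> nat \<Rightarrow> nat \<Rightarrow> 'a" where
  "q_binomial q n k = (if k \<le> n then q_fact q n / (q_fact q k * q_fact q (n - k)) else 0)"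

text \<open>
  The exponent of \<open>q\<close> inside the sum can be negative, hence the integer power. The natural-number
  subtractions \<open>n - k\<close> and \<open>k - j\<close> do not truncate, since \<open>j \<le> k \<le> n\<close> in the sum.
\<close>

definition t_sum :: "nat \<Rightarrow> nat \<Rightarrow> nat \<Rightarrow> 'a::field \<Rightarrow> 'a" where
  "t_sum r n j q =
     q ^ (r * ((j + 1) choose 2)) *
     (\<Sum>k=j..n. (- 1) ^ (n - k)
        * ((1 - q ^ (2 * k + 1)) / (1 - q ^ (n + k + 1)))
        * q_binomial q (2 * n) (n - k)
        * q_binomial q (k + j) (k - j) ^ r
        * q powi (int (k choose 2) - int r * int j * int k))"

text \<open>The image of \<open>\<nat>[q]\<close> in \<open>\<int>(q)\<close>.\<close>

definition nat_polys :: "int poly fract set" where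
  "nat_polys = range (\<lambda>p :: nat poly. to_fract (map_poly int p))"

end

theory Submission
  imports Defs
begin

text \<open>
  Put \<open>x\<^sub>k = q^(-k) + q^(k+1)\<close>. Up to normalization, \<open>q^(-jk) [k+j, k-j]\<close> is the Newton polynomial
  \<open>\<Prod>i<j. (x - x\<^sub>i)\<close> at \<open>x = x\<^sub>k\<close>, and the alternating sum over \<open>k\<close> is the divided difference
  at \<open>x\<^sub>0, \<dots>, x\<^sub>n\<close>. Hence \<open>t\<close> is the \<open>n\<close>-th Newton coefficient of the \<open>r\<close>-th power of the \<open>j\<close>-th
  Newton polynomial. A \<open>q\<close>-Pfaff-Saalschuetz formula linearizes products of Newton polynomials; after
  rescaling the basis, its coefficients are products of \<open>q\<close>-binomials and a power of \<open>q\<close>, whose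
  negative part is absorbed by \<open>q^((r-1) (n choose 2))\<close>. Iterating it gives a manifestly nonnegative
  recursion in \<open>r\<close>.
\<close>

section \<open>q-factorials and q-binomials at a generic \<open>q\<close>\<close>

lemma q_fact_0 [simp]: "q_fact q 0 = 1"
  by (simp add: q_fact_def)

lemma q_fact_Suc: "q_fact q (Suc n) = (1 - q ^ Suc n) * q_fact q n"
  by (simp add: q_fact_def)

text \<open>As \<open>q\<close> is neither zero nor a root of unity, every \<open>q_fact q n\<close>
  is invertible. The identities are proved at this level and transferred to \<open>qvar\<close> at
  the end.\<close>

locale generic_base =
  fixes q :: "'a::field"
  assumes q_nonzero [simp]: "q \<noteq> 0"
    and q_power_neq_1: "i > 0 \<Longrightarrow> q ^ i \<noteq> 1"
begin

lemma one_minus_q_power [simp]: "i > 0 \<Longrightarrow> 1 - q ^ i \<noteq> 0"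
  using q_power_neq_1[of i] by simp

lemma q_fact_nonzero [simp]: "q_fact q n \<noteq> 0"
  using q_power_neq_1 by (auto simp: q_fact_def)

lemma q_binomial_0 [simp]: "q_binomial q n 0 = 1"
  by (simp add: q_binomial_def)

lemma q_binomial_self [simp]: "q_binomial q n n = 1"
  by (simp add: q_binomial_def)

lemma q_binomial_eq_0 [simp]: "n < k \<Longrightarrow> q_binomial q n k = 0"
  by (simp add: q_binomial_def)

lemma q_binomial_add: "q_binomial q (a + b) a = q_fact q (a + b) / (q_fact q a * q_fact q b)"
  by (simp add: q_binomial_def)

lemma q_binomial_absorb:
  "(1 - q ^ Suc n) * q_binomial q n k = (1 - q ^ Suc k) * q_binomial q (Suc n) (Suc k)"
proof (cases "k \<le> n")
  case True
  have "1 - q ^ Suc k \<noteq> 0" by (rule one_minus_q_power) simp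
  with True show ?thesis
    by (simp add: q_binomial_def q_fact_Suc divide_simps del: power_Suc)
qed simp

lemma q_binomial_absorb_comp:
  "(1 - q ^ Suc (l + d)) * q_binomial q (l + d) (Suc l) = (1 - q ^ d) * q_binomial q (Suc (l + d)) (Suc l)"
proof (cases d)
  case (Suc c)
  have "1 - q ^ Suc l \<noteq> 0" "1 - q ^ Suc c \<noteq> 0" by (rule one_minus_q_power; simp)+
  with Suc show ?thesis
    by (simp add: q_binomial_def q_fact_Suc divide_simps del: power_Suc)
qed simp

text \<open>The q-Pascal rule, from
  \<open>1 - q^(n+1) = (1 - q^(k+1)) + q^(k+1) * (1 - q^(n-k))\<close>. Its nonnegative coefficients
  later place the q-binomials in \<open>nat_polys\<close>.\<close>

lemma q_binomial_Suc_Suc: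
  "q_binomial q (Suc n) (Suc k) = q_binomial q n k + q ^ Suc k * q_binomial q n (Suc k)"
proof (cases "k < n")
  case True
  then obtain e where n: "n = Suc k + e" using less_iff_Suc_add by auto
  have nz: "1 - q ^ Suc k \<noteq> 0" "1 - q ^ Suc e \<noteq> 0"
    by (rule one_minus_q_power; simp)+
  have 1: "q_binomial q (Suc n) (Suc k)
      = (1 - q ^ Suc n) * q_fact q n / ((1 - q ^ Suc k) * q_fact q k * ((1 - q ^ Suc e) * q_fact q e))"
    using q_binomial_add[of "Suc k" "Suc e"] by (simp only: q_fact_Suc n add_Suc_right)
  have 2: "q_binomial q n k = q_fact q n / (q_fact q k * ((1 - q ^ Suc e) * q_fact q e))"
    using q_binomial_add[of k "Suc e"] by (simp only: q_fact_Suc[of q e] n add_Suc_right add_Suc)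
  have 3: "q_binomial q n (Suc k) = q_fact q n / ((1 - q ^ Suc k) * q_fact q k * q_fact q e)"
    using q_binomial_add[of "Suc k" "e"] by (simp only: q_fact_Suc[of q k] n)
  have *: "1 - q ^ Suc n = (1 - q ^ Suc k) + q ^ Suc k * (1 - q ^ Suc e)"
    by (simp add: n algebra_simps power_add)
  show ?thesis unfolding 1 2 3 * using nz by (simp add: divide_simps del: power_Suc) (simp add: algebra_simps)
next
  case False
  then show ?thesis by (cases "k = n") auto
qed

section \<open>Newton polynomials at the nodes\<close>

definition node :: "nat \<Rightarrow> 'a" where
  "node k = inverse (q ^ k) + q ^ Suc k"

definition newton :: "nat \<Rightarrow> nat \<Rightarrow> 'a" where
  "newton j k = (\<Prod>i<j. node k - node i)"

text \<open>The expression \<open>node k\<close> is invariant under \<open>k -> -k-1\<close>, so the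
  difference vanishes at \<open>i = k\<close> and at \<open>i = -k-1\<close>; each root contributes
  one factor.\<close>

lemma node_diff: "i \<le> k \<Longrightarrow> node k - node i = inverse (q ^ k) * (1 - q ^ (k - i)) * (1 - q ^ (k + i + 1))"
  by (auto simp: node_def le_iff_add field_simps power_add)

lemma newton_0 [simp]: "newton 0 k = 1"
  by (simp add: newton_def)

lemma newton_Suc: "newton (Suc j) k = newton j k * (node k - node j)"
  by (simp add: newton_def)

lemma newton_eq_0 [simp]: "k < j \<Longrightarrow> newton j k = 0"
  by (auto simp: newton_def)

text \<open>The factors \<open>1 - q^(k-i)\<close> multiply to \<open>(q)_k / (q)_(k-j)\<close> and
  the factors \<open>1 - q^(k+i+1)\<close> to \<open>(q)_(k+j) / (q)_k\<close>.\<close>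

lemma newton_closed:
  "j \<le> k \<Longrightarrow> newton j k = inverse (q ^ (j * k)) * q_fact q (k + j) / q_fact q (k - j)"
proof (induction j)
  case (Suc j)
  then obtain e where k: "k = Suc j + e" using le_Suc_ex by blast
  have nz: "1 - q ^ Suc e \<noteq> 0" by (rule one_minus_q_power) simp
  have "newton (Suc j) k = inverse (q ^ (j * k)) * q_fact q (k + j) / ((1 - q ^ Suc e) * q_fact q e)
      * (inverse (q ^ k) * (1 - q ^ Suc e) * (1 - q ^ Suc (k + j)))"
    using Suc.IH Suc.prems node_diff[of j k]
    by (simp add: newton_Suc k Suc_diff_le q_fact_Suc[of q e] del: power_Suc)
  also have "\<dots> = inverse (q ^ (j * k)) * inverse (q ^ k) * ((1 - q ^ Suc (k + j)) * q_fact q (k + j)) / q_fact q e"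
    using nz by (simp add: divide_simps del: power_Suc)
  finally show ?case by (simp add: k q_fact_Suc power_add mult_ac)
qed simp

section \<open>Linearization of products of Newton polynomials\<close>

text \<open>The coefficient of \<open>newton (n + l)\<close> in \<open>newton j * newton n\<close>
  for \<open>j <= n\<close>, where \<open>n + l - j\<close> does not truncate. For
  \<open>l > j\<close> the truncation of \<open>j - l\<close> is harmless because the q-binomial is
  0.\<close>

definition linearization :: "nat \<Rightarrow> nat \<Rightarrow> nat \<Rightarrow> 'a" where
  "linearization n j l = inverse (q ^ ((j - l) * (n + l))) * q_binomial q j l * q_fact q (n + j) * q_fact q n
     / (q_fact q (n + l) * q_fact q (n + l - j))"

lemma linearization_eq_0 [simp]: "j < l \<Longrightarrow> linearization n j l = 0"
  by (simp add: linearization_def)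

lemma linearization_Suc_0:
  assumes "Suc j \<le> n"
  shows "linearization n (Suc j) 0 = (node n - node j) * linearization n j 0"
proof -
  obtain e where n: "n = Suc j + e" using assms le_Suc_ex by blast
  have nz: "1 - q ^ Suc e \<noteq> 0" by (rule one_minus_q_power) simp
  have 1: "linearization n (Suc j) 0 = inverse (q ^ (Suc j * n)) * q_fact q (Suc (n + j)) / q_fact q e"
    by (simp add: linearization_def n)
  have 2: "linearization n j 0 = inverse (q ^ (j * n)) * q_fact q (n + j) / q_fact q (Suc e)"
    by (simp add: linearization_def n)
  have 3: "node n - node j = inverse (q ^ n) * (1 - q ^ Suc e) * (1 - q ^ Suc (n + j))"
    using node_diff[of j n] by (simp add: n)
  show ?thesis
    unfolding 1 2 3 using nz by (simp add: q_fact_Suc power_add divide_simps del: power_Suc)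
qed

text \<open>The recursion produced by one more factor \<open>node k - node j\<close>: one
  contribution raises the index of the Newton polynomial, the other keeps it.\<close>

lemma linearization_Suc_Suc:
  assumes "Suc j \<le> n" "l \<le> j"
  shows "linearization n (Suc j) (Suc l)
    = linearization n j l + (node (n + Suc l) - node j) * linearization n j (Suc l)"
proof -
  obtain e where n: "n = Suc j + e" using assms le_Suc_ex by blast
  have nz: "1 - q ^ Suc (e + l) \<noteq> 0" "1 - q ^ Suc (Suc e + l) \<noteq> 0" "1 - q ^ Suc (n + l) \<noteq> 0"
      "1 - q ^ Suc l \<noteq> 0"
    by (rule one_minus_q_power; simp)+
  obtain d where j: "j = l + d" using assms le_Suc_ex by blast
  have nd: "node (n + Suc l) - node j
      = inverse (q ^ (n + Suc l)) * (1 - q ^ Suc (Suc e + l)) * (1 - q ^ (n + Suc l + j + 1))"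
    using node_diff[of j "n + Suc l"] by (simp add: n)
  \<comment> \<open>The common factor of all three terms; only q-binomials and single factors
    \<open>1 - q^i\<close> remain beside it.\<close>
  define Z where "Z = inverse (q ^ (d * (n + Suc l))) * q_fact q (n + j) * q_fact q n
      / (q_fact q (Suc (n + l)) * q_fact q (Suc (e + l)))"
  have 1: "linearization n (Suc j) (Suc l) = Z * q_binomial q (Suc j) (Suc l) * (1 - q ^ Suc (n + j))"
    by (simp add: linearization_def Z_def n j q_fact_Suc[of q "n + j"] del: power_Suc)
      (simp add: n j q_fact_Suc)
  have 2: "linearization n j l = Z * q ^ d * q_binomial q j l * (1 - q ^ Suc (n + l))"
    using nz by (simp add: linearization_def Z_def n j q_fact_Suc[of q "n + l"] 
       power_add divide_simps del: power_Suc) (simp add: n j q_fact_Suc power_add mult_ac)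
  have 3: "(node (n + Suc l) - node j) * linearization n j (Suc l)
      = Z * q_binomial q j (Suc l) * (1 - q ^ (n + Suc l + j + 1))"
  proof (cases d)
    case (Suc c)
    then show ?thesis
      using nz unfolding nd
      by (simp add: linearization_def Z_def n j power_add divide_simps del: power_Suc)
        (simp add: n j q_fact_Suc power_add mult_ac)
  qed (simp add: j)
  define B where "B = q_binomial q (Suc j) (Suc l)"
  have nzj: "1 - q ^ Suc j \<noteq> 0" by (rule one_minus_q_power) simp
  have 4: "q_binomial q j l = (1 - q ^ Suc l) / (1 - q ^ Suc j) * B"
    using q_binomial_absorb[of j l] nzj by (simp add: B_def field_simps del: power_Suc)
  have 5: "q_binomial q j (Suc l) = (1 - q ^ d) / (1 - q ^ Suc j) * B"
    using q_binomial_absorb_comp[of l d] nzj by (simp add: B_def j field_simps del: power_Suc)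
  \<comment> \<open>After division by \<open>Z\<close> and by \<open>B\<close>, the whole recursion
    reduces to this polynomial identity.\<close>
  have "(1 - q ^ Suc j) * (1 - q ^ Suc (n + j))
      = q ^ d * (1 - q ^ Suc l) * (1 - q ^ Suc (n + l)) + (1 - q ^ d) * (1 - q ^ (n + Suc l + j + 1))"
    by (simp add: j power_add algebra_simps)
  then have 6: "1 - q ^ Suc (n + j)
      = q ^ d * ((1 - q ^ Suc l) / (1 - q ^ Suc j)) * (1 - q ^ Suc (n + l))
        + (1 - q ^ d) / (1 - q ^ Suc j) * (1 - q ^ (n + Suc l + j + 1))"
    using nzj by (simp add: divide_simps del: power_Suc) (simp add: mult_ac)
  show ?thesis
    unfolding 1 2 3 4 5 6 B_def[symmetric] by (simp only: algebra_simps)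
qed

lemma newton_mult:
  assumes "j \<le> n"
  shows "newton j k * newton n k = (\<Sum>l\<le>j. linearization n j l * newton (n + l) k)"
  using assms
proof (induction j)
  case 0
  then show ?case by (simp add: linearization_def)
next
  case (Suc j)
  let ?c = "\<lambda>l. (node (n + l) - node j) * linearization n j l"
  have "newton (Suc j) k * newton n k = (newton j k * newton n k) * (node k - node j)"
    by (simp add: newton_Suc)
  also have "\<dots> = (\<Sum>l\<le>j. linearization n j l * newton (n + l) k * (node k - node j))"
    using Suc by (simp add: sum_distrib_right)
  \<comment> \<open>Here \<open>node k - node j\<close> is split as
    \<open>(node k - node (n + l)) + (node (n + l) - node j)\<close>; the first summand extends
    \<open>newton (n + l)\<close>.\<close>
  also have "\<dots> = (\<Sum>l\<le>j. linearization n j l * newton (n + Suc l) k + ?c l * newton (n + l) k)"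
    by (intro sum.cong) (auto simp: newton_Suc algebra_simps)
  \<comment> \<open>The added term \<open>l = Suc j\<close> is zero; it aligns the two sums for the
    index shift.\<close>
  also have "\<dots> = (\<Sum>l\<le>j. linearization n j l * newton (n + Suc l) k)
      + (\<Sum>l\<le>Suc j. ?c l * newton (n + l) k)"
    by (simp add: sum.distrib)
  also have "\<dots> = ?c 0 * newton n k
      + (\<Sum>l\<le>j. (linearization n j l + ?c (Suc l)) * newton (n + Suc l) k)"
    by (subst sum.atMost_Suc_shift) (simp add: sum.distrib[symmetric] algebra_simps)
  also have "\<dots> = linearization n (Suc j) 0 * newton n k
      + (\<Sum>l\<le>j. linearization n (Suc j) (Suc l) * newton (n + Suc l) k)"
    using Suc.prems by (intro arg_cong2[of _ _ _ _ "(+)"] sum.cong)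
      (auto simp: linearization_Suc_0 linearization_Suc_Suc)
  also have "\<dots> = (\<Sum>l\<le>Suc j. linearization n (Suc j) l * newton (n + l) k)"
    by (simp add: sum.atMost_Suc_shift del: sum.atMost_Suc)
  finally show ?case .
qed

section \<open>Normalized basis and the divided-difference functional\<close>

text \<open>Normalized so that the \<open>r\<close>-th power of \<open>basis j k\<close> is exactly
  the part of the summand of \<open>t_sum\<close> that depends on \<open>r\<close>, prefactor
  included.\<close>

definition basis :: "nat \<Rightarrow> nat \<Rightarrow> 'a" where
  "basis m k = q ^ (Suc m choose 2) * newton m k / q_fact q (2 * m)"

text \<open>Up to a factor depending only on \<open>n\<close>, this is the divided-difference
  weight, the reciprocal of the product of \<open>node k - node i\<close> over
  \<open>i <= n\<close>, \<open>i\<close> distinct from \<open>k\<close>.\<close>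

definition weight :: "nat \<Rightarrow> nat \<Rightarrow> 'a" where
  "weight n k = (- 1) ^ (n - k) * ((1 - q ^ (2 * k + 1)) / (1 - q ^ (n + k + 1)))
     * q_binomial q (2 * n) (n - k) * q ^ (k choose 2)"

lemma basis_eq_0 [simp]: "k < m \<Longrightarrow> basis m k = 0"
  by (simp add: basis_def)

lemma basis_closed:
  assumes "m \<le> k"
  shows "basis m k = q ^ (Suc m choose 2) * inverse (q ^ (m * k)) * q_binomial q (k + m) (k - m)"
proof -
  have "k + m - (k - m) = 2 * m" using assms by simp
  then have "q_binomial q (k + m) (k - m) = q_fact q (k + m) / (q_fact q (k - m) * q_fact q (2 * m))"
    by (simp add: q_binomial_def)
  then show ?thesis using assms by (simp add: basis_def newton_closed)
qed

lemma t_sum_eq: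
  assumes "r > 0"
  shows "t_sum r n j q = (\<Sum>k\<le>n. weight n k * basis j k ^ r)"
proof -
  \<comment> \<open>The terms with \<open>k < j\<close> vanish because \<open>basis j k = 0\<close>
    and \<open>r > 0\<close>.\<close>
  have "(\<Sum>k\<le>n. weight n k * basis j k ^ r) = (\<Sum>k=j..n. weight n k * basis j k ^ r)"
    using assms by (intro sum.mono_neutral_right) auto
  also have "\<dots> = t_sum r n j q"
    unfolding t_sum_def sum_distrib_left
  proof (intro sum.cong refl)
    fix k assume k: "k \<in> {j..n}"
    have "q powi (int (k choose 2) - int r * int j * int k)
        = q ^ (k choose 2) * inverse (q ^ (j * k)) ^ r"
      by (simp add: power_int_diff field_simps flip: of_nat_mult power_mult)
    moreover have "basis j k ^ r
        = q ^ (r * (j + 1 choose 2)) * inverse (q ^ (j * k)) ^ r * q_binomial q (k + j) (k - j) ^ r"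
      using k by (simp add: basis_closed power_mult_distrib mult.commute[of r] flip: power_mult)
    ultimately show "weight n k * basis j k ^ r = q ^ (r * (j + 1 choose 2)) *
         ((- 1) ^ (n - k) * ((1 - q ^ (2 * k + 1)) / (1 - q ^ (n + k + 1))) *
          q_binomial q (2 * n) (n - k) * q_binomial q (k + j) (k - j) ^ r *
          q powi (int (k choose 2) - int r * int j * int k))"
      by (simp only: weight_def mult_ac)
  qed
  finally show ?thesis ..
qed

text \<open>
  The factor \<open>1 - q ^ (2 * k + 1)\<close> makes the sum telescope (Gosper summation); the right-hand side
  vanishes for \<open>e = 0\<close>.
\<close>

lemma weight_basis_partial_sum:
  fixes m d e :: nat
  defines "n \<equiv> m + d + e"
  shows "(1 - q ^ (d + e)) * (\<Sum>k=m..m+d. (- 1) ^ k * (1 - q ^ (2 * k + 1)) * q ^ (k choose 2)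
        * inverse (q ^ (m * k)) * q_fact q (k + m) / (q_fact q (k - m) * q_fact q (n - k) * q_fact q (n + k + 1)))
    = (- 1) ^ (m + d) * q ^ (Suc (m + d) choose 2) * inverse (q ^ (m * Suc (m + d)))
      * q_fact q (2 * m + d + 1) * (1 - q ^ e) / (q_fact q d * q_fact q e * q_fact q (n + m + d + 1))"
  unfolding n_def
proof (induction d arbitrary: e)
  case 0
  show ?case
    by (simp add: q_fact_Suc numeral_2_eq_2 power_add mult_2 field_simps)
next
  case (Suc d)
  \<comment> \<open>The hypothesis is used at \<open>Suc e\<close>, which keeps the total
    \<open>n\<close> fixed while the partial sum gains a term; hence the generalization over
    \<open>e\<close>.\<close>
  define n where "n = m + d + Suc e"
  define X where "X = (- 1) ^ (m + d) * q ^ (Suc (m + d) choose 2) * inverse (q ^ (m * Suc (m + d)))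
      * q_fact q (2 * m + d + 1) / (q_fact q d * q_fact q e * q_fact q (n + m + d + 1))"
  define A where "A = 1 - q ^ Suc d"
  define B where "B = 1 - q ^ Suc (n + m + d + 1)"
  define E where "E = 1 - q ^ Suc e"
  have nz: "A \<noteq> 0" "B \<noteq> 0" "E \<noteq> 0"
    unfolding A_def B_def E_def by (rule one_minus_q_power; simp)+
  let ?k = "m + Suc d"
  let ?f = "\<lambda>k. (- 1) ^ k * (1 - q ^ (2 * k + 1)) * q ^ (k choose 2)
        * inverse (q ^ (m * k)) * q_fact q (k + m) / (q_fact q (k - m) * q_fact q (n - k) * q_fact q (n + k + 1))"
  have "(1 - q ^ (Suc d + e)) * sum ?f {m..m + Suc d}
      = (1 - q ^ (d + Suc e)) * sum ?f {m..m + d} + (1 - q ^ (d + Suc e)) * ?f ?k"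
    by (simp add: algebra_simps)
  also have "(1 - q ^ (d + Suc e)) * sum ?f {m..m + d} = X"
    unfolding n_def Suc.IH[of "Suc e"] 
    using nz by (simp add: X_def E_def n_def q_fact_Suc[of q e] mult_ac del: power_Suc)
  also have "?f ?k = - X * ((1 - q ^ (2 * ?k + 1)) / (A * B))"
  proof -
    have "?k + m = 2 * m + d + 1" "?k - m = Suc d" "n - ?k = e" "n + ?k + 1 = Suc (n + m + d + 1)"
      by (simp_all add: n_def)
    moreover have "q_fact q (Suc d) = A * q_fact q d"
        "q_fact q (Suc (n + m + d + 1)) = B * q_fact q (n + m + d + 1)"
      by (simp_all only: A_def B_def q_fact_Suc)
    ultimately show ?thesis
      by (simp only: X_def) (simp add: mult_ac)
  qed
  also have "X + (1 - q ^ (d + Suc e)) * (- X * ((1 - q ^ (2 * ?k + 1)) / (A * B)))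
      = X * ((A * B - (1 - q ^ (d + Suc e)) * (1 - q ^ (2 * ?k + 1))) / (A * B))"
  proof -
    have "X + t * (- X * (g / (A * B))) = X * ((A * B - t * g) / (A * B))" for t g
      using nz by (simp add: diff_divide_distrib right_diff_distrib)
    then show ?thesis .
  qed
  also have "A * B - (1 - q ^ (d + Suc e)) * (1 - q ^ (2 * ?k + 1))
      = - (q ^ Suc d) * (1 - q ^ Suc (2 * m + d + 1)) * (1 - q ^ e)"
  proof -
    \<comment> \<open>With these powers as independent variables, the telescoping condition is a
      polynomial identity.\<close>
    define a b c where "a = q ^ m" "b = q ^ d" "c = q ^ e"
    have eqs: "A = 1 - q * b" "B = 1 - q ^ 3 * a ^ 2 * b ^ 2 * c"
        "q ^ (d + Suc e) = q * b * c" "q ^ (2 * ?k + 1) = q ^ 3 * a ^ 2 * b ^ 2"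
        "q ^ Suc (2 * m + d + 1) = q ^ 2 * a ^ 2 * b"
      by (simp_all add: A_def B_def n_def a_b_c_def power_add power_mult power_mult_distrib
          power2_eq_square power3_eq_cube mult_ac)
    show ?thesis
      unfolding eqs
      by (simp add: a_b_c_def(2,3)[symmetric] algebra_simps power2_eq_square power3_eq_cube)
  qed
  also have "X * (\<dots> / (A * B)) = (- 1) ^ (m + Suc d) * q ^ (Suc (m + Suc d) choose 2) * inverse (q ^ (m * Suc (m + Suc d)))
      * q_fact q (2 * m + Suc d + 1) * (1 - q ^ e) / (q_fact q (Suc d) * q_fact q e * q_fact q (n + m + Suc d + 1))"
  proof -
    have "q_fact q (Suc d) = A * q_fact q d" "q_fact q (n + m + Suc d + 1) = B * q_fact q (n + m + d + 1)"
      "q_fact q (2 * m + Suc d + 1) = (1 - q ^ Suc (2 * m + d + 1)) * q_fact q (2 * m + d + 1)"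
      by (simp_all add: A_def B_def q_fact_Suc)
    moreover have "q ^ (Suc (m + Suc d) choose 2) * inverse (q ^ (m * Suc (m + Suc d)))
        = q ^ Suc d * (q ^ (Suc (m + d) choose 2) * inverse (q ^ (m * Suc (m + d))))"
    proof -
      have "Suc (m + Suc d) choose 2 = (Suc (m + d) choose 2) + (m + Suc d)"
        "m * Suc (m + Suc d) = m * Suc (m + d) + m"
        by (simp_all add: numeral_2_eq_2)
      then show ?thesis
        by (simp only: power_add inverse_mult_distrib) simp
    qed
    ultimately show ?thesis
      unfolding X_def by (simp add: mult_ac)
  qed
  finally show ?case by (simp add: n_def)
qed

text \<open>An \<open>n\<close>-th divided difference annihilates Newton polynomials of lower
  degree. For \<open>m = n\<close> only the term \<open>k = n\<close> survives, and the
  normalization makes it 1.\<close>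

lemma weight_basis_orthogonal:
  assumes "m \<le> n"
  shows "(\<Sum>k\<le>n. weight n k * basis m k) = of_bool (m = n)"
proof -
  define f where "f k = (- 1) ^ k * (1 - q ^ (2 * k + 1)) * q ^ (k choose 2)
        * inverse (q ^ (m * k)) * q_fact q (k + m) / (q_fact q (k - m) * q_fact q (n - k) * q_fact q (n + k + 1))" for k
  define c where "c = (- 1) ^ n * q_fact q (2 * n) * q ^ (Suc m choose 2) / q_fact q (2 * m)"
  have "(\<Sum>k\<le>n. weight n k * basis m k) = (\<Sum>k=m..n. weight n k * basis m k)"
    by (intro sum.mono_neutral_right) auto
  also have "\<dots> = (\<Sum>k=m..n. c * f k)"
  proof (intro sum.cong refl)
    fix k assume "k \<in> {m..n}"
    then have k: "m \<le> k" "k \<le> n" by auto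
    have nz: "1 - q ^ Suc (n + k) \<noteq> 0" by (rule one_minus_q_power) simp
    have "2 * n - (n - k) = n + k" using k by simp
    then have "q_binomial q (2 * n) (n - k) = q_fact q (2 * n) / (q_fact q (n - k) * q_fact q (n + k))"
      by (simp add: q_binomial_def)
    moreover have "q_binomial q (k + m) (k - m) = q_fact q (k + m) / (q_fact q (k - m) * q_fact q (2 * m))"
      using k by (simp add: q_binomial_def mult_2)
    moreover have "(- 1) ^ (n - k) = (- 1 :: 'a) ^ n * (- 1) ^ k"
      using k by (simp add: minus_one_power_iff)
    moreover have "basis m k = q ^ (Suc m choose 2) * inverse (q ^ (m * k)) * q_binomial q (k + m) (k - m)"
      using k by (simp add: basis_closed)
    ultimately show "weight n k * basis m k = c * f k"
      using nz by (simp only: weight_def c_def f_def)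
        (simp add: q_fact_Suc divide_simps mult_ac del: power_Suc)
  qed
  also have "\<dots> = of_bool (m = n)"
  proof (cases "m = n")
    case True
    have nz: "1 - q ^ Suc (2 * n) \<noteq> 0" by (rule one_minus_q_power) simp
    have "(n choose 2) + (Suc n choose 2) = n * n"
      by (induction n) (auto simp: numeral_2_eq_2)
    then have "q ^ (n choose 2) * q ^ (Suc n choose 2) = q ^ (n * n)"
      by (simp flip: power_add)
    moreover have "(- 1) ^ n * (- 1) ^ n = (1 :: 'a)"
      by (simp flip: power_mult_distrib)
    moreover have "c * f n = ((- 1) ^ n * (- 1) ^ n) * (q ^ (n choose 2) * q ^ (Suc n choose 2)) * inverse (q ^ (n * n))"
      using True nz by (simp add: c_def f_def mult_2[symmetric] q_fact_Suc del: power_Suc)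
    ultimately show ?thesis using True by simp
  next
    case False
    then have *: "1 - q ^ (n - m) \<noteq> 0" using assms by (intro one_minus_q_power) simp
    \<comment> \<open>The full sum is the partial sum with \<open>e = 0\<close>, and the factor on
      the left is invertible.\<close>
    have "(1 - q ^ (n - m)) * sum f {m..n} = 0"
      using weight_basis_partial_sum[of "n - m" 0 m] assms by (simp add: f_def)
    with * False show ?thesis by (simp add: sum_distrib_left[symmetric])
  qed
  finally show ?thesis .
qed

text \<open>
  With this scaling, every structure constant of the product \<open>basis j * basis n\<close> becomes
  a product of two \<open>q\<close>-binomials and a power of \<open>q\<close>.
\<close>

definition scale :: "nat \<Rightarrow> nat \<Rightarrow> 'a" where
  "scale j m = q_binomial q m j * q_binomial q (2 * m) m / q_binomial q (2 * j) j"

definition step :: "nat \<Rightarrow> nat \<Rightarrow> nat \<Rightarrow> 'a" where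
  "step j n m = inverse (q ^ (j * n)) * q ^ (Suc (j - (m - n)) choose 2)
     * q_binomial q j (m - n) * q_binomial q (n + j) (2 * j)"

lemma step_eq_0 [simp]: "n + j < m \<Longrightarrow> step j n m = 0"
  by (simp add: step_def)

lemma scale_self [simp]: "scale j j = 1"
  by (simp add: scale_def q_binomial_def)

lemma scale_linearization:
  assumes "j \<le> n" "l \<le> j"
  shows "scale j n * q ^ (Suc j choose 2) * q ^ (Suc n choose 2) * linearization n j l
      / (q_fact q (2 * j) * q_fact q (2 * n))
    = step j n (n + l) * scale j (n + l) * q ^ (Suc (n + l) choose 2) / q_fact q (2 * (n + l))"
proof -
  obtain d where j: "j = l + d" using assms le_Suc_ex by blast
  have "(Suc (l + d) choose 2) + (Suc n choose 2) + (l + d) * n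
      = (Suc d choose 2) + (Suc (n + l) choose 2) + d * (n + l)"
    by (induction l) (auto simp: numeral_2_eq_2)
  then have "q ^ (Suc j choose 2) * q ^ (Suc n choose 2) * q ^ (j * n)
      = q ^ (Suc d choose 2) * q ^ (Suc (n + l) choose 2) * q ^ (d * (n + l))"
    by (simp add: j flip: power_add)
  then have *: "q ^ (Suc j choose 2) * q ^ (Suc n choose 2) * inverse (q ^ (d * (n + l)))
      = inverse (q ^ (j * n)) * q ^ (Suc d choose 2) * q ^ (Suc (n + l) choose 2)"
    by (simp add: field_simps)
  have "scale j n * q_fact q (n + j) * q_fact q n
      / (q_fact q (2 * j) * q_fact q (2 * n) * q_fact q (n + l) * q_fact q (n + l - j))
    = q_binomial q (n + j) (2 * j) * scale j (n + l) / q_fact q (2 * (n + l))"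
    using assms by (simp add: scale_def q_binomial_def mult_2 field_simps)
  then have "(q ^ (Suc j choose 2) * q ^ (Suc n choose 2) * inverse (q ^ (d * (n + l)))) * q_binomial q j l *
      (scale j n * q_fact q (n + j) * q_fact q n
      / (q_fact q (2 * j) * q_fact q (2 * n) * q_fact q (n + l) * q_fact q (n + l - j)))
    = (inverse (q ^ (j * n)) * q ^ (Suc d choose 2) * q ^ (Suc (n + l) choose 2)) * q_binomial q j l *
      (q_binomial q (n + j) (2 * j) * scale j (n + l) / q_fact q (2 * (n + l)))"
    using * by simp
  then show ?thesis
    by (simp add: linearization_def step_def j mult_ac)
qed

lemma basis_mult:
  assumes "j \<le> n" "k \<le> N"
  shows "scale j n * basis j k * basis n k = (\<Sum>m=n..N. step j n m * scale j m * basis m k)"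
proof -
  have "scale j n * basis j k * basis n k
      = scale j n * q ^ (Suc j choose 2) * q ^ (Suc n choose 2) / (q_fact q (2 * j) * q_fact q (2 * n))
        * (newton j k * newton n k)"
    by (simp add: basis_def)
  also have "\<dots> = (\<Sum>l\<le>j. (scale j n * q ^ (Suc j choose 2) * q ^ (Suc n choose 2) * linearization n j l
      / (q_fact q (2 * j) * q_fact q (2 * n))) * newton (n + l) k)"
    using assms by (simp add: newton_mult sum_distrib_left sum_divide_distrib mult_ac)
  also have "\<dots> = (\<Sum>l\<le>j. step j n (n + l) * scale j (n + l) * basis (n + l) k)"
    using assms by (intro sum.cong refl) (subst scale_linearization; simp add: basis_def)
  also have "\<dots> = (\<Sum>m=n..n+j. step j n m * scale j m * basis m k)"
    by (rule sum.reindex_bij_witness[of _ "\<lambda>m. m - n" "\<lambda>l. n + l"]) auto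
  also have "\<dots> = (\<Sum>m=n..N. step j n m * scale j m * basis m k)"
    using assms by (intro sum.mono_neutral_cong) auto
  finally show ?thesis .
qed

primrec coefficient :: "nat \<Rightarrow> nat \<Rightarrow> nat \<Rightarrow> 'a" where
  "coefficient j 0 m = of_bool (m = j)"
| "coefficient j (Suc s) m = (\<Sum>n=j..m. step j n m * coefficient j s n)"

lemma basis_power:
  assumes "k \<le> N"
  shows "basis j k ^ Suc s = (\<Sum>m=j..N. scale j m * coefficient j s m * basis m k)"
proof (induction s)
  case 0
  have "(\<Sum>m=j..N. scale j m * coefficient j 0 m * basis m k)
      = (\<Sum>m=j..N. if m = j then basis j k else 0)"
    by (intro sum.cong) auto
  then show ?case using assms by auto
next
  case (Suc s)
  have "basis j k ^ Suc (Suc s)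
      = (\<Sum>n=j..N. coefficient j s n * (scale j n * basis j k * basis n k))"
    unfolding power_Suc[of _ "Suc s"] Suc.IH by (simp add: sum_distrib_left mult_ac)
  also have "\<dots> = (\<Sum>n=j..N. \<Sum>m\<in>{m\<in>{j..N}. n \<le> m}.
      coefficient j s n * (step j n m * scale j m * basis m k))"
    unfolding sum_distrib_left[symmetric]
    using assms by (intro sum.cong refl) (auto simp: basis_mult intro!: sum.cong)
  also have "\<dots> = (\<Sum>m=j..N. \<Sum>n\<in>{n\<in>{j..N}. n \<le> m}.
      coefficient j s n * (step j n m * scale j m * basis m k))"
    by (rule sum.swap_restrict) auto
  also have "\<dots> = (\<Sum>m=j..N. scale j m * coefficient j (Suc s) m * basis m k)"
    by (intro sum.cong refl)
      (auto simp: sum_distrib_left sum_distrib_right mult_ac intro!: sum.cong)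
  finally show ?case .
qed

lemma t_sum_Suc:
  "t_sum (Suc s) n j q = (if j \<le> n then scale j n * coefficient j s n else 0)"
proof -
  have "t_sum (Suc s) n j q
      = (\<Sum>k\<le>n. \<Sum>m=j..n. scale j m * coefficient j s m * (weight n k * basis m k))"
    unfolding t_sum_eq[OF zero_less_Suc]
    by (intro sum.cong refl) (simp add: basis_power[of _ n] sum_distrib_left mult_ac del: power_Suc)
  also have "\<dots> = (\<Sum>m=j..n. scale j m * coefficient j s m * (\<Sum>k\<le>n. weight n k * basis m k))"
    by (subst sum.swap) (simp add: sum_distrib_left)
  also have "\<dots> = (\<Sum>m=j..n. if m = n then scale j n * coefficient j s n else 0)"
    by (intro sum.cong refl) (auto simp: weight_basis_orthogonal)
  finally show ?thesis by simp
qed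

end

lemma zero_nat_polys [simp]: "0 \<in> nat_polys"
  unfolding nat_polys_def by (rule range_eqI[of _ _ 0]) simp

lemma one_nat_polys [simp]: "1 \<in> nat_polys"
  unfolding nat_polys_def by (rule range_eqI[of _ _ 1]) simp

lemma add_nat_polys:
  assumes "x \<in> nat_polys" "y \<in> nat_polys"
  shows "x + y \<in> nat_polys"
proof -
  have "map_poly int (p + p') = map_poly int p + map_poly int p'" for p p'
    by (rule poly_eqI) (simp add: coeff_map_poly)
  then show ?thesis
    using assms unfolding nat_polys_def image_iff by (metis UNIV_I to_fract_add)
qed

lemma mult_nat_polys:
  assumes "x \<in> nat_polys" "y \<in> nat_polys"
  shows "x * y \<in> nat_polys"
proof -
  have "map_poly int (p * p') = map_poly int p * map_poly int p'" for p p'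
    by (rule poly_eqI) (simp add: coeff_map_poly coeff_mult)
  then show ?thesis
    using assms unfolding nat_polys_def image_iff by (metis UNIV_I to_fract_mult)
qed

lemma sum_nat_polys: "(\<And>i. i \<in> A \<Longrightarrow> f i \<in> nat_polys) \<Longrightarrow> sum f A \<in> nat_polys"
  by (induction A rule: infinite_finite_induct) (auto intro: add_nat_polys)

lemma qvar_power: "qvar ^ i = to_fract (monom 1 i)"
  by (induction i) (simp_all add: qvar_def monom_Suc flip: to_fract_mult)

lemma qvar_power_nat_polys [simp]: "qvar ^ i \<in> nat_polys"
proof -
  have "map_poly int (monom 1 i) = monom 1 i"
    by (subst map_poly_monom) simp_all
  then show ?thesis
    unfolding nat_polys_def qvar_power by (metis rangeI)
qed

interpretation qvar: generic_base qvar
proof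
  show "qvar \<noteq> 0" by (simp add: qvar_def)
  show "qvar ^ i \<noteq> 1" if "i > 0" for i
  proof
    assume "qvar ^ i = 1"
    then have "to_fract (monom 1 i :: int poly) = to_fract 1" by (simp add: qvar_power)
    then have "degree (monom 1 i :: int poly) = degree (1 :: int poly)"
      by (simp only: to_fract_eq_iff)
    with that show False by (simp add: degree_monom_eq)
  qed
qed

lemma q_binomial_nat_polys [simp]: "q_binomial qvar n k \<in> nat_polys"
proof (induction n arbitrary: k)
  case 0
  then show ?case by (cases k) auto
next
  case (Suc n)
  then show ?case
    by (cases k) (auto simp: qvar.q_binomial_Suc_Suc simp del: power_Suc intro!: add_nat_polys mult_nat_polys)
qed

lemma step_exponent:
  "(2 * l + d + a choose 2) + (Suc d choose 2)
    = (l + d) * (l + d + a) + ((a choose 2) + l * a + 2 * (l choose 2))"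
proof (induction l)
  case 0
  show ?case by (induction d) (simp_all add: numeral_2_eq_2)
next
  case (Suc l)
  then show ?case by (simp add: numeral_2_eq_2)
qed

lemma step_nat_polys:
  assumes "j \<le> n" "n \<le> m"
  shows "qvar ^ (m choose 2) * qvar.step j n m \<in> nat_polys"
proof (cases "m \<le> n + j")
  case True
  define l where "l = m - n"
  define a where "a = n - j"
  define d where "d = j - l"
  define E where "E = (a choose 2) + l * a + 2 * (l choose 2)"
  have eqs: "m - n = l" "j - (m - n) = d" "m = 2 * l + d + a" "j * n = (l + d) * (l + d + a)"
    using assms True by (auto simp: l_def a_def d_def)
  have "qvar ^ (m choose 2) * qvar ^ (Suc d choose 2) = qvar ^ (j * n) * qvar ^ E"
    unfolding power_add[symmetric] E_def eqs(3,4) step_exponent ..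
  then have E: "qvar ^ E = qvar ^ (m choose 2) * qvar ^ (Suc d choose 2) * inverse (qvar ^ (j * n))"
    by simp
  then have "qvar ^ (m choose 2) * qvar.step j n m
      = qvar ^ E * (q_binomial qvar j l * q_binomial qvar (n + j) (2 * j))"
    unfolding qvar.step_def eqs(2) unfolding eqs(1) E by (simp only: mult_ac)
  then show ?thesis by (auto intro!: mult_nat_polys)
qed simp

lemma coefficient_nat_polys: "qvar ^ (s * (m choose 2)) * qvar.coefficient j s m \<in> nat_polys"
proof (induction s arbitrary: m)
  case (Suc s)
  have "qvar ^ (Suc s * (m choose 2)) * (qvar.step j n m * qvar.coefficient j s n) \<in> nat_polys"
    if "n \<in> {j..m}" for n
  proof -
    have "n choose 2 \<le> m choose 2"
      using that by (intro binomial_right_mono) simp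
    then have "s * (m choose 2) = s * ((m choose 2) - (n choose 2)) + s * (n choose 2)"
      by (simp flip: add_mult_distrib2)
    then have "qvar ^ (Suc s * (m choose 2)) * (qvar.step j n m * qvar.coefficient j s n)
        = qvar ^ (s * ((m choose 2) - (n choose 2))) * (qvar ^ (m choose 2) * qvar.step j n m)
          * (qvar ^ (s * (n choose 2)) * qvar.coefficient j s n)"
      by (simp only: mult_Suc power_add mult_ac)
    also have "\<dots> \<in> nat_polys"
      using that by (intro mult_nat_polys step_nat_polys Suc.IH) auto
    finally show ?thesis .
  qed
  then show ?case
    unfolding qvar.coefficient.simps sum_distrib_left by (rule sum_nat_polys)
qed simp

theorem theorem1p6:
  fixes r n j :: nat
  assumes "r \<ge> 2" and "n \<ge> 1" and "j \<ge> 1"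
  shows "qvar ^ ((r - 1) * (n choose 2)) * q_binomial qvar (2 * j) j
           * inverse (q_binomial qvar (2 * n) n) * t_sum r n j qvar \<in> nat_polys"
proof -
  define s where "s = r - 1"
  have r: "r = Suc s" using assms(1) by (simp add: s_def)
  have nz: "q_binomial qvar (2 * k) k \<noteq> 0" for k
    by (simp add: q_binomial_def)
  show ?thesis
  proof (cases "j \<le> n")
    case True
    have "qvar ^ ((r - 1) * (n choose 2)) * q_binomial qvar (2 * j) j
           * inverse (q_binomial qvar (2 * n) n) * t_sum r n j qvar
        = q_binomial qvar n j * (qvar ^ (s * (n choose 2)) * qvar.coefficient j s n)"
      using True nz[of n] nz[of j] by (simp add: r qvar.t_sum_Suc qvar.scale_def)
    then show ?thesis
      by (simp add: mult_nat_polys coefficient_nat_polys)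
  qed (simp add: r qvar.t_sum_Suc)
qed

end
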